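(* Let $F(x,t)=\gamma(x)+t\xi(x)$ be a $k$-th pseudo cylindrical developable surface with unit normal vector field $\nu=\xi\times\xi_d$, and let $(0,t_0)$ be a singular point of $F$ on the ruling $x=0$. Then $F$ is a wave front at $(0,t_0)$ if and only if $\rho(0)\neq 0$, where $\rho=\det(\xi,\xi_d,\xi_d')$.
   Context: Let $I\subset\mathbb{R}$ be an open interval containing $0$ (all statements are local at $x=0$, so $I$ may be shrunk), and let $\gamma:I\to\mathbb{R}^3$ with $\gamma(0)=0$ and $\xi:I\to S^2$ be real analytic. The ruled surface is $F:I\times\mathbb{R}\to\mathbb{R}^3$, $F(x,t)=\gamma(x)+t\xi(x)$. It is called $k$-th pseudo cylindrical ($k\in\mathbb{Z}_{\ge 0}$) if $\xi'(x)=\tilde\xi(x)x^{k}$ with $\tilde\xi(0)\neq\mathbf 0$; $I$ is taken so small that $\tilde\xi$ has no zeros on $I$. Put $\xi_d=\tilde\xi/\|\tilde\xi\|$, so $\{\xi,\xi_d,\xi\times\xi_d\}$ is an orthonormal frame. The functions $p,q,r:I\to\mathbb{R}$ are defined by $\gamma'=p\,\xi+q\,\xi_d+r\,(\xi\times\xi_d)$. $F$ is a developable surface (vanishing Gaussian curvature on the regular part), equivalently $r\equiv 0$; then $\nu(x,t)=\xi(x)\times\xi_d(x)$ is orthogonal to $F_x$ and $F_t$ everywhere. A point is singular if $\operatorname{rank} dF<2$ there. $F$ is a wave front at a point if $L=(F,\nu):I\times\mathbb{R}\to\mathbb{R}^3\times S^2$ is an immersion at that point. *)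

theory Defs
  imports "HOL-Analysis.Analysis"
begin

definition real_analytic_on :: "(real \<Rightarrow> 'a::real_normed_vector) \<Rightarrow> real set \<Rightarrow> bool" where
  "real_analytic_on f S \<longleftrightarrow>
     (\<forall>a\<in>S. \<exists>c. \<exists>r>0. \<forall>x. \<bar>x - a\<bar> < r \<longrightarrow> (\<lambda>n. (x - a) ^ n *\<^sub>R c n) sums f x)"

definition ruled_surface :: "(real \<Rightarrow> real^3) \<Rightarrow> (real \<Rightarrow> real^3) \<Rightarrow> real \<times> real \<Rightarrow> real^3" where
  "ruled_surface \<gamma> \<xi> = (\<lambda>(x, t). \<gamma> x + t *\<^sub>R \<xi> x)"

(* The field \<eta> is the factor in \<xi>'(x) = x^k \<eta>(x). It is determined by \<xi> and k: by division away
   from 0, and at 0 by continuity, so carrying it as an argument adds no freedom on I. *)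
definition pseudo_cylindrical ::
    "nat \<Rightarrow> real set \<Rightarrow> (real \<Rightarrow> real^3) \<Rightarrow> (real \<Rightarrow> real^3) \<Rightarrow> bool" where
  "pseudo_cylindrical k I \<xi> \<eta> \<longleftrightarrow>
     real_analytic_on \<eta> I \<and>
     (\<forall>x\<in>I. (\<xi> has_vector_derivative x ^ k *\<^sub>R \<eta> x) (at x)) \<and>
     \<eta> 0 \<noteq> 0"

definition unit_field :: "(real \<Rightarrow> real^3) \<Rightarrow> real \<Rightarrow> real^3" where
  "unit_field \<eta> x = \<eta> x /\<^sub>R norm (\<eta> x)"

definition ruled_normal :: "(real \<Rightarrow> real^3) \<Rightarrow> (real \<Rightarrow> real^3) \<Rightarrow> real \<times> real \<Rightarrow> real^3" where
  "ruled_normal \<xi> \<eta> = (\<lambda>(x, t). cross3 (\<xi> x) (unit_field \<eta> x))"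

definition rho :: "(real \<Rightarrow> real^3) \<Rightarrow> (real \<Rightarrow> real^3) \<Rightarrow> real \<Rightarrow> real" where
  "rho \<xi> \<eta> x =
     det (vector [\<xi> x, unit_field \<eta> x, vector_derivative (unit_field \<eta>) (at x)] :: real^3^3)"

definition singular_point :: "(real \<times> real \<Rightarrow> real^3) \<Rightarrow> real \<times> real \<Rightarrow> bool" where
  "singular_point F z \<longleftrightarrow> dim (range (frechet_derivative F (at z))) < 2"

definition partial_x :: "(real \<times> real \<Rightarrow> real^3) \<Rightarrow> real \<times> real \<Rightarrow> real^3" where
  "partial_x F = (\<lambda>(x, t). vector_derivative (\<lambda>s. F (s, t)) (at x))"

definition partial_t :: "(real \<times> real \<Rightarrow> real^3) \<Rightarrow> real \<times> real \<Rightarrow> real^3" where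
  "partial_t F = (\<lambda>(x, t). vector_derivative (\<lambda>s. F (x, s)) (at t))"

(* Quotient of the determinants of the second and first fundamental forms; meaningful only at
   regular points, where the denominators do not vanish. *)
definition gaussian_curvature :: "(real \<times> real \<Rightarrow> real^3) \<Rightarrow> real \<times> real \<Rightarrow> real" where
  "gaussian_curvature F z =
     (let Fx = partial_x F z; Ft = partial_t F z;
          n = cross3 Fx Ft /\<^sub>R norm (cross3 Fx Ft);
          L = partial_x (partial_x F) z \<bullet> n;
          M = partial_t (partial_x F) z \<bullet> n;
          N = partial_t (partial_t F) z \<bullet> n
      in (L * N - M\<^sup>2) / ((Fx \<bullet> Fx) * (Ft \<bullet> Ft) - (Fx \<bullet> Ft)\<^sup>2))"

definition developable_on :: "(real \<times> real) set \<Rightarrow> (real \<times> real \<Rightarrow> real^3) \<Rightarrow> bool" where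
  "developable_on U F \<longleftrightarrow> (\<forall>z\<in>U. \<not> singular_point F z \<longrightarrow> gaussian_curvature F z = 0)"

definition immersion_at ::
    "('a::real_normed_vector \<Rightarrow> 'b::real_normed_vector) \<Rightarrow> 'a \<Rightarrow> bool" where
  "immersion_at f z \<longleftrightarrow> f differentiable (at z) \<and> inj (frechet_derivative f (at z))"

(* The target R^3 x S^2 is a submanifold of R^3 x R^3, so immersivity may be tested in the latter. *)
definition wave_front_at ::
    "(real \<times> real \<Rightarrow> real^3) \<Rightarrow> (real \<times> real \<Rightarrow> real^3) \<Rightarrow> real \<times> real \<Rightarrow> bool" where
  "wave_front_at F \<nu> z \<longleftrightarrow> immersion_at (\<lambda>w. (F w, \<nu> w)) z"

end

(* At a singular point the two columns of dF are linearly dependent, so dF(a, b) = (a c + b) \<xi>(0)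
   for some c, and the normal varies by d\<nu>(a, b) = a (\<xi> \<times> \<xi>_d')(0). Hence (F, \<nu>) is an immersion
   iff \<xi> \<times> \<xi>_d' \<noteq> 0 at 0. Since \<xi>_d' is orthogonal to \<xi>_d, this vector equals -\<rho> \<xi>_d. *)
theory Submission
  imports Defs
begin

text \<open>Near \<open>a\<close> each coordinate of \<open>f\<close> is a scalar power series in
  \<open>x - a\<close>, which may be differentiated termwise; differentiability of all coordinates
  gives that of \<open>f\<close>.\<close>

lemma real_analytic_on_imp_differentiable:
  fixes f :: "real \<Rightarrow> 'a::euclidean_space"
  assumes "real_analytic_on f S" and "a \<in> S"
  shows "f differentiable (at a)"
proof -
  obtain c r where r: "r > 0"
    and c: "\<And>x. \<bar>x - a\<bar> < r \<Longrightarrow> (\<lambda>n. (x - a) ^ n *\<^sub>R c n) sums f x"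
    using assms unfolding real_analytic_on_def by blast
  have "(\<lambda>x. f x \<bullet> i) differentiable (at a)" for i
  proof -
    have s: "(\<lambda>n. (c n \<bullet> i) * (x - a) ^ n) sums (f x \<bullet> i)" if "\<bar>x - a\<bar> < r" for x
      using bounded_linear.sums[OF bounded_linear_inner_left c[OF that], of i]
      by (simp add: mult.commute)
    have "summable (\<lambda>n. (c n \<bullet> i) * z ^ n)" if "norm z < r" for z
      using s[of "z + a"] that by (simp add: sums_iff)
    \<comment> \<open>The series is differentiated at its centre \<open>0\<close>; the result is
      then moved to \<open>a\<close> by a translation.\<close>
    then obtain D where "((\<lambda>z. \<Sum>n. (c n \<bullet> i) * z ^ n) has_field_derivative D) (at 0)"
      using termdiffs_strong'[of r "\<lambda>n. c n \<bullet> i" 0] r by auto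
    then have "((\<lambda>x. \<Sum>n. (c n \<bullet> i) * (x - a) ^ n) has_field_derivative D) (at a)"
      using DERIV_shift[of "\<lambda>z. \<Sum>n. (c n \<bullet> i) * z ^ n" D a "- a"] by simp
    then have "((\<lambda>x. f x \<bullet> i) has_field_derivative D) (at a)"
      using r by (rule has_field_derivative_transform_within)
        (use s in \<open>auto simp: dist_real_def sums_iff\<close>)
    then show ?thesis
      using real_differentiable_def by blast
  qed
  then show ?thesis
    by (subst differentiable_componentwise_within) auto
qed

text \<open>In the orthonormal frame \<open>u\<close>, \<open>e\<close>, \<open>cross3 u e\<close>,
  the vector \<open>cross3 u w\<close> has no component along \<open>u\<close>, and none along
  \<open>cross3 u e\<close> because \<open>w\<close> is orthogonal to \<open>e\<close>. What remains
  is a multiple of \<open>e\<close>, whose coefficient is the determinant up to sign.\<close>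

lemma cross3_eq_0_iff_det_eq_0:
  fixes u e w :: "real^3"
  assumes "u \<bullet> u = 1" and "e \<bullet> e = 1" and "u \<bullet> e = 0" and "e \<bullet> w = 0"
  shows "cross3 u w = 0 \<longleftrightarrow> det (vector [u, e, w] :: real^3^3) = 0"
proof -
  \<comment> \<open>The sign comes from exchanging the first two rows.\<close>
  have det: "det (vector [u, e, w] :: real^3^3) = - (e \<bullet> cross3 u w)"
    unfolding dot_cross_det by (simp add: det_3)
  have "cross3 u w = (e \<bullet> cross3 u w) *\<^sub>R e"
  proof (rule ccontr)
    \<comment> \<open>The part of \<open>cross3 u w\<close> orthogonal to \<open>e\<close>; it turns
      out to be orthogonal to the whole frame and hence zero.\<close>
    define v where "v = cross3 u w - (e \<bullet> cross3 u w) *\<^sub>R e"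
    assume "\<not> ?thesis"
    then have "v \<noteq> 0" by (simp add: v_def)
    have ev: "e \<bullet> v = 0" and uv: "u \<bullet> v = 0"
      using assms by (simp_all add: v_def inner_diff_right dot_cross_self)
    have "cross3 u e \<bullet> cross3 u w = (u \<bullet> u) * (e \<bullet> w) - (u \<bullet> w) * (e \<bullet> u)"
      by (simp add: cross3_simps)
    then have nv: "cross3 u e \<bullet> v = 0"
      using assms by (simp add: v_def inner_diff_right dot_cross_self inner_commute)
    have "cross3 (cross3 u e) v = (u \<bullet> v) *\<^sub>R e - (e \<bullet> v) *\<^sub>R u"
      by (simp add: cross3_simps forall_3)
    then have "cross3 (cross3 u e) v = 0"
      by (simp add: ev uv)
    \<comment> \<open>By Lagrange's identity, two vectors with zero cross product and zero inner
      product have norms with product zero. The same identity for \<open>u\<close> and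
      \<open>e\<close> shows that \<open>cross3 u e\<close> is a unit vector.\<close>
    then have "(norm (cross3 u e) * norm v)\<^sup>2 = 0"
      using norm_cross_dot[of "cross3 u e" v] nv by simp
    moreover have "(norm (cross3 u e))\<^sup>2 = 1"
      using norm_cross_dot[of u e] assms by (simp add: norm_eq_sqrt_inner)
    ultimately show False
      using \<open>v \<noteq> 0\<close> by auto
  qed
  then show ?thesis
    unfolding det by (metis inner_zero_right neg_equal_0_iff_equal scale_zero_left)
qed

lemma has_derivative_ruled_surface:
  assumes "(\<gamma> has_vector_derivative g) (at x)" and "(\<xi> has_vector_derivative d) (at x)"
  shows "(ruled_surface \<gamma> \<xi> has_derivative (\<lambda>(a, b). a *\<^sub>R (g + t *\<^sub>R d) + b *\<^sub>R \<xi> x)) (at (x, t))"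
proof -
  have fst: "(fst has_derivative fst) (at (x, t))" and snd: "(snd has_derivative snd) (at (x, t))"
    by (auto intro: derivative_eq_intros)
  have g: "((\<lambda>z. \<gamma> (fst z)) has_derivative (\<lambda>z. fst z *\<^sub>R g)) (at (x, t))"
    using has_derivative_compose[OF fst, of \<gamma>] assms(1)
    by (simp add: has_vector_derivative_def)
  have d: "((\<lambda>z. \<xi> (fst z)) has_derivative (\<lambda>z. fst z *\<^sub>R d)) (at (x, t))"
    using has_derivative_compose[OF fst, of \<xi>] assms(2)
    by (simp add: has_vector_derivative_def)
  have "((\<lambda>z. \<gamma> (fst z) + snd z *\<^sub>R \<xi> (fst z)) has_derivative
      (\<lambda>z. fst z *\<^sub>R g + (t *\<^sub>R (fst z *\<^sub>R d) + snd z *\<^sub>R \<xi> x))) (at (x, t))"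
    using has_derivative_add[OF g has_derivative_scaleR[OF snd d]] by simp
  then show ?thesis
    by (simp add: ruled_surface_def case_prod_beta' algebra_simps)
qed

text \<open>Otherwise \<open>v\<close> and \<open>w\<close> would be two independent vectors in the
  range. With \<open>v\<close> and \<open>w\<close> the two partial derivatives of the surface, this
  turns singularity into proportionality.\<close>

lemma dim_span_pair_less_2:
  fixes v w :: "'a::euclidean_space"
  assumes "dim (range (\<lambda>(a, b). a *\<^sub>R v + b *\<^sub>R w)) < 2" and "w \<noteq> 0"
  obtains c where "v = c *\<^sub>R w"
proof -
  let ?R = "range (\<lambda>(a, b). a *\<^sub>R v + b *\<^sub>R w)"
  have "v = (\<lambda>(a, b). a *\<^sub>R v + b *\<^sub>R w) (1, 0)" "w = (\<lambda>(a, b). a *\<^sub>R v + b *\<^sub>R w) (0, 1)"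
    by auto
  then have sub: "{v, w} \<subseteq> ?R"
    by (metis (no_types, lifting) empty_subsetI insert_subset rangeI)
  have "v \<in> span {w}"
  proof (rule ccontr)
    assume nv: "v \<notin> span {w}"
    then have "independent {v, w}"
      using assms(2) by (simp add: independent_insert)
    then have "card {v, w} \<le> dim ?R"
      using sub by (rule independent_card_le_dim[rotated])
    moreover have "v \<noteq> w"
      using nv span_base by auto
    ultimately show False
      using assms(1) by simp
  qed
  then show thesis
    using that by (auto simp: span_singleton)
qed

text \<open>Differentiate the constant function \<open>f x \<bullet> f x = 1\<close>. This serves
  both for \<xi> and for the unit field of \<eta>.\<close>

lemma inner_vector_derivative_eq_0:
  fixes f :: "real \<Rightarrow> 'a::real_inner"
  assumes "open S" and "a \<in> S" and "\<And>x. x \<in> S \<Longrightarrow> norm (f x) = 1"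
    and "(f has_vector_derivative f') (at a)"
  shows "f a \<bullet> f' = 0"
proof -
  have "((\<lambda>x. f x \<bullet> f x) has_vector_derivative (f a \<bullet> f' + f' \<bullet> f a)) (at a)"
    using bounded_bilinear.has_vector_derivative[OF bounded_bilinear_inner assms(4,4)] .
  then have "((\<lambda>x. 1::real) has_vector_derivative (f a \<bullet> f' + f' \<bullet> f a)) (at a)"
    by (rule has_vector_derivative_transform_within_open[OF _ assms(1,2)])
      (simp add: assms(3) dot_square_norm)
  then have "f a \<bullet> f' + f' \<bullet> f a = 0"
    using has_vector_derivative_const by (rule vector_derivative_unique_at)
  then show ?thesis
    by (simp add: inner_commute)
qed

text \<open>Orthogonality of \<xi> and \<xi>' passes to \<eta> for \<open>x \<noteq> 0\<close> on
  dividing by \<open>x ^ k\<close>. At \<open>0\<close> this division fails when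
  \<open>k > 0\<close>, so the value there is obtained as a limit, by continuity.\<close>

lemma pseudo_cylindrical_inner_eq_0:
  assumes "open I" and "0 \<in> I" and "\<xi> ` I \<subseteq> sphere 0 1"
    and "pseudo_cylindrical k I \<xi> \<eta>"
  shows "\<xi> 0 \<bullet> \<eta> 0 = 0"
proof -
  have der: "(\<xi> has_vector_derivative x ^ k *\<^sub>R \<eta> x) (at x)" if "x \<in> I" for x
    using assms(4) that by (simp add: pseudo_cylindrical_def)
  have zero: "\<xi> x \<bullet> \<eta> x = 0" if x: "x \<in> I" "x \<noteq> 0" for x
  proof -
    have "norm (\<xi> y) = 1" if "y \<in> I" for y
      using assms(3) that by auto
    then have "\<xi> x \<bullet> (x ^ k *\<^sub>R \<eta> x) = 0"
      using inner_vector_derivative_eq_0[OF assms(1) x(1) _ der[OF x(1)]] by blast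
    then show ?thesis
      using x by simp
  qed
  have "isCont \<eta> 0"
    using assms(2,4) real_analytic_on_imp_differentiable[of \<eta> I 0] differentiable_imp_continuous_within
    by (auto simp: pseudo_cylindrical_def)
  then have "isCont (\<lambda>x. \<xi> x \<bullet> \<eta> x) 0"
    using has_vector_derivative_continuous[OF der[OF assms(2)]] by (intro continuous_inner) auto
  then have "((\<lambda>x. \<xi> x \<bullet> \<eta> x) \<longlongrightarrow> \<xi> 0 \<bullet> \<eta> 0) (at 0)"
    by (simp add: isCont_def)
  moreover have "\<forall>\<^sub>F x in at 0. \<xi> x \<bullet> \<eta> x = 0"
    using eventually_at_in_open[OF assms(1,2)] by eventually_elim (use zero in auto)
  then have "((\<lambda>x. \<xi> x \<bullet> \<eta> x) \<longlongrightarrow> 0) (at 0)"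
    by (rule tendsto_eventually)
  ultimately show ?thesis
    by (rule tendsto_unique[rotated]) simp
qed

theorem proposition3p9:
  fixes I :: "real set" and k :: nat and \<gamma> \<xi> \<eta> :: "real \<Rightarrow> real^3" and t0 :: real
  assumes "open I" and "is_interval I" and "0 \<in> I"
    and "real_analytic_on \<gamma> I" and "\<gamma> 0 = 0"
    and "real_analytic_on \<xi> I" and "\<xi> ` I \<subseteq> sphere 0 1"
    and "pseudo_cylindrical k I \<xi> \<eta>"
    and "\<forall>x\<in>I. \<eta> x \<noteq> 0"
    and "developable_on (I \<times> UNIV) (ruled_surface \<gamma> \<xi>)"
    and "singular_point (ruled_surface \<gamma> \<xi>) (0, t0)"
  shows "wave_front_at (ruled_surface \<gamma> \<xi>) (ruled_normal \<xi> \<eta>) (0, t0) \<longleftrightarrow> rho \<xi> \<eta> 0 \<noteq> 0"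
proof -
  define e where "e = unit_field \<eta>"
  have \<eta>0: "\<eta> 0 \<noteq> 0" and unit: "\<xi> 0 \<bullet> \<xi> 0 = 1"
    using assms(3,7,9) by (auto simp: norm_eq_1)
  have "\<eta> differentiable (at 0)"
    using assms(3,8) by (auto simp: pseudo_cylindrical_def intro: real_analytic_on_imp_differentiable)
  moreover have "(\<lambda>x. norm (\<eta> x)) differentiable (at 0)"
    using differentiable_compose[OF differentiable_norm_at[OF \<eta>0] calculation] .
  ultimately have "e differentiable (at 0)"
    unfolding e_def unit_field_def using \<eta>0
    by (intro differentiable_scaleR differentiable_inverse) auto
  then obtain w where w: "(e has_vector_derivative w) (at 0)"
    using vector_derivative_works by blast
  obtain g where g: "(\<gamma> has_vector_derivative g) (at 0)"
    using real_analytic_on_imp_differentiable[OF assms(4,3)] vector_derivative_works by blast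
  \<comment> \<open>The factor \<open>0 ^ k\<close> is \<open>1\<close> for \<open>k = 0\<close> and
    \<open>0\<close> otherwise; leaving it unevaluated treats both cases at once.\<close>
  have d: "(\<xi> has_vector_derivative 0 ^ k *\<^sub>R \<eta> 0) (at 0)"
    using assms(3,8) by (simp add: pseudo_cylindrical_def)
  have dF: "(ruled_surface \<gamma> \<xi> has_derivative
      (\<lambda>(a, b). a *\<^sub>R (g + t0 *\<^sub>R (0 ^ k *\<^sub>R \<eta> 0)) + b *\<^sub>R \<xi> 0)) (at (0, t0))"
    using has_derivative_ruled_surface[OF g d] .
  have "dim (range (\<lambda>(a, b). a *\<^sub>R (g + t0 *\<^sub>R (0 ^ k *\<^sub>R \<eta> 0)) + b *\<^sub>R \<xi> 0)) < 2"
    using assms(11) unfolding singular_point_def frechet_derivative_at[OF dF, symmetric] .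
  \<comment> \<open>The left side is the \<open>x\<close>-derivative of the surface at
    \<open>(0, t0)\<close>, and \<open>\<xi> 0\<close>, nonzero by \<open>unit\<close>, is its
    \<open>t\<close>-derivative.\<close>
  then obtain c where c: "g + t0 *\<^sub>R (0 ^ k *\<^sub>R \<eta> 0) = c *\<^sub>R \<xi> 0"
    using unit by (metis dim_span_pair_less_2 inner_zero_left zero_neq_one)
  \<comment> \<open>The term \<open>\<xi>' \<times> e\<close> of the product rule vanishes because \<open>e\<close> is parallel to \<open>\<xi>'\<close>.\<close>
  have "cross3 (0 ^ k *\<^sub>R \<eta> 0) (e 0) = 0"
    by (simp add: e_def unit_field_def cross_mult_left cross_mult_right)
  moreover have "bounded_bilinear cross3"
    using bilinear_cross bilinear_conv_bounded_bilinear by blast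
  ultimately have "((\<lambda>x. cross3 (\<xi> x) (e x)) has_vector_derivative cross3 (\<xi> 0) w) (at 0)"
    using bounded_bilinear.has_vector_derivative[OF _ d w] by fastforce
  \<comment> \<open>The normal is constant along rulings, so only the first coordinate enters its
    derivative.\<close>
  then have d\<nu>: "(ruled_normal \<xi> \<eta> has_derivative (\<lambda>z. fst z *\<^sub>R cross3 (\<xi> 0) w)) (at (0, t0))"
    using has_derivative_compose[of fst fst "(0, t0)" UNIV "\<lambda>x. cross3 (\<xi> x) (e x)"]
    by (simp add: ruled_normal_def e_def case_prod_beta' has_vector_derivative_def
        bounded_linear_imp_has_derivative bounded_linear_fst)
  have dL: "((\<lambda>z. (ruled_surface \<gamma> \<xi> z, ruled_normal \<xi> \<eta> z)) has_derivative
      (\<lambda>z. ((fst z * c + snd z) *\<^sub>R \<xi> 0, fst z *\<^sub>R cross3 (\<xi> 0) w))) (at (0, t0))"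
    using has_derivative_Pair[OF dF d\<nu>] unfolding c by (simp add: case_prod_beta' scaleR_add_left)
  have "inj (\<lambda>z. ((fst z * c + snd z) *\<^sub>R \<xi> 0, fst z *\<^sub>R cross3 (\<xi> 0) w)) \<longleftrightarrow> cross3 (\<xi> 0) w \<noteq> 0"
    (is "inj ?L \<longleftrightarrow> _")
  proof
    assume inj: "inj ?L"
    show "cross3 (\<xi> 0) w \<noteq> 0"
    proof
      assume "cross3 (\<xi> 0) w = 0"
      then show False
        \<comment> \<open>The vector \<open>(1, - c)\<close> spans the kernel of the derivative of
          the surface, so injectivity of \<open>?L\<close> depends on whether the normal varies in
          this direction.\<close>
        using inj_eq[OF inj, of "(1, - c)" "(0, 0)"] by simp
    qed
  next
    assume "cross3 (\<xi> 0) w \<noteq> 0"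
    moreover have "\<xi> 0 \<noteq> 0"
      using unit by auto
    ultimately show "inj ?L"
      by (auto simp: inj_on_def)
  qed
  moreover have "wave_front_at (ruled_surface \<gamma> \<xi>) (ruled_normal \<xi> \<eta>) (0, t0) \<longleftrightarrow> inj ?L"
    using dL unfolding wave_front_at_def immersion_at_def frechet_derivative_at[OF dL, symmetric]
    by (auto simp: differentiable_def)
  moreover have "cross3 (\<xi> 0) w = 0 \<longleftrightarrow> rho \<xi> \<eta> 0 = 0"
  proof -
    have "e 0 \<bullet> e 0 = 1"
      using \<eta>0 by (simp add: e_def unit_field_def dot_square_norm power2_eq_square)
    moreover have "\<xi> 0 \<bullet> e 0 = 0"
      using pseudo_cylindrical_inner_eq_0[OF assms(1,3,7,8)] by (simp add: e_def unit_field_def)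
    moreover have "norm (e x) = 1" if "x \<in> I" for x
      using assms(9) that by (simp add: e_def unit_field_def)
    \<comment> \<open>The field \<open>e\<close> has unit length on all of \<open>I\<close>, so its
      derivative \<open>w\<close> is orthogonal to it; this completes the hypotheses on the frame at
      \<open>0\<close>.\<close>
    then have "e 0 \<bullet> w = 0"
      using inner_vector_derivative_eq_0[OF assms(1,3) _ w] by blast
    ultimately show ?thesis
      using cross3_eq_0_iff_det_eq_0[OF unit] vector_derivative_at[OF w]
      by (simp add: rho_def e_def)
  qed
  ultimately show ?thesis
    by blast
qed

end
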